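(* Let $\Gamma$ be a metrized graph with $v \geq 3$ vertices and let $k$ be an integer with $1 \leq k \leq v-2$. For admissible contractions, $$\frac{(v-2)!}{(v-k-2)!}\,x(\Gamma) = \sum_{e_{i_1} \in E(\Gamma)}\frac{R_{i_1}}{L_{i_1}+R_{i_1}} \sum_{e_{i_2} \in E(\overline{\Gamma}_{i_1})}\frac{R_{i_2}}{L_{i_2}+R_{i_2}}\cdots\sum_{e_{i_k} \in E(\overline{\Gamma}_{i_1, \dots, i_{k-1}})}\frac{R_{i_k}}{L_{i_k}+R_{i_k}}\, x(\overline{\Gamma}_{i_1,\dots, i_k}),$$ and the same identity holds with $x$ replaced by $y$ throughout.
   Context: A metrized graph $\Gamma$ is a finite connected graph (multiple edges and self-loops allowed) each of whose edges is identified with a closed segment of positive length, with a finite nonempty vertex set $V(\Gamma)$ containing every point of valence $\neq2$; $v=\#V(\Gamma)$, $E(\Gamma)$ its edge set, $L_i$ the length of $e_i$. For an edge $e_i$ with end points $p_i,q_i$: if $\Gamma-e_i$ (interior deleted) is connected, $R_i$ is the effective resistance between $p_i,q_i$ in $\Gamma-e_i$ (edges as resistors of resistance equal to length), $R_{a_i,p}=\hat j_{p_i}(p,q_i)$, $R_{b_i,p}=\hat j_{q_i}(p,p_i)$ with $\hat j_z(x,y)$ the voltage function of $\Gamma-e_i$ (potential at $x$ when unit current enters at $y$, exits at $z$, potential $0$ at $z$); if $e_i$ is a bridge, $R_{a_i,p}=0,R_{b_i,p}=R_i$ for $p$ in the component of $\Gamma-e_i$ containing $p_i$ and $R_{a_i,p}=R_i,R_{b_i,p}=0$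 otherwise, and expressions in $R_i$ are interpreted as limits as $R_i\to\infty$; for a self-loop $R_i=0$. For a fixed vertex $p$ (values independent of $p$): $y(\Gamma)=\frac14\sum_{e_i}\frac{L_iR_i^2}{(L_i+R_i)^2}+\frac34\sum_{e_i}\frac{L_i(R_{a_i,p}-R_{b_i,p})^2}{(L_i+R_i)^2}$ and $x(\Gamma)=\sum_{e_i}\frac{L_i^2R_i}{(L_i+R_i)^2}+\frac34\sum_{e_i}\frac{L_iR_i^2}{(L_i+R_i)^2}-\frac34\sum_{e_i}\frac{L_i(R_{a_i,p}-R_{b_i,p})^2}{(L_i+R_i)^2}$. $\overline\Gamma_{i_1,\dots,i_k}$ is obtained by successively contracting $e_{i_1}\in E(\Gamma)$ to a point, then $e_{i_2}\in E(\overline\Gamma_{i_1})$, etc. (vertex sets being images); $L_{i_j},R_{i_j}$ are computed in the graph $\overline\Gamma_{i_1,\dots,i_{j-1}}$. A contraction is admissible if each contracted edge has distinct end points (self-loop terms vanish anyway since $R=0$). *)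

theory Defs
  imports Complex_Main
begin

text \<open>A metrized graph is modelled combinatorially: a finite vertex set, a finite set of
  edges (multiple edges and self-loops allowed), each edge with an ordered pair of end points
  (p_i, q_i) and a length.  The edge is identified with a segment of that length.\<close>

record ('v, 'e) mgraph =
  verts :: "'v set"
  edges :: "'e set"
  ends  :: "'e \<Rightarrow> 'v \<times> 'v"
  len   :: "'e \<Rightarrow> real"

definition adj :: "('v, 'e) mgraph \<Rightarrow> 'v \<Rightarrow> 'v \<Rightarrow> bool" where
  "adj G u w \<longleftrightarrow> (\<exists>e\<in>edges G. ends G e = (u, w) \<or> ends G e = (w, u))"

definition reach :: "('v, 'e) mgraph \<Rightarrow> 'v \<Rightarrow> 'v \<Rightarrow> bool" where
  "reach G = (adj G)\<^sup>*\<^sup>*"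

definition connected_graph :: "('v, 'e) mgraph \<Rightarrow> bool" where
  "connected_graph G \<longleftrightarrow> (\<forall>u\<in>verts G. \<forall>w\<in>verts G. reach G u w)"

definition metrized_graph :: "('v, 'e) mgraph \<Rightarrow> bool" where
  "metrized_graph G \<longleftrightarrow> finite (verts G) \<and> verts G \<noteq> {} \<and> finite (edges G) \<and>
     (\<forall>e\<in>edges G. fst (ends G e) \<in> verts G \<and> snd (ends G e) \<in> verts G \<and> len G e > 0) \<and>
     connected_graph G"

definition delete_edge :: "('v, 'e) mgraph \<Rightarrow> 'e \<Rightarrow> ('v, 'e) mgraph" where
  "delete_edge G e = G\<lparr>edges := edges G - {e}\<rparr>"

definition contract :: "('v, 'e) mgraph \<Rightarrow> 'e \<Rightarrow> ('v, 'e) mgraph" where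
  "contract G e =
     (let p = fst (ends G e); q = snd (ends G e); f = (\<lambda>w. if w = q then p else w) in
      \<lparr>verts = f ` verts G, edges = edges G - {e},
       ends = (\<lambda>d. map_prod f f (ends G d)), len = len G\<rparr>)"

text \<open>Net current flowing out of vertex w for the potential f (edges are resistors of
  resistance equal to their length).\<close>
definition net_flow :: "('v, 'e) mgraph \<Rightarrow> ('v \<Rightarrow> real) \<Rightarrow> 'v \<Rightarrow> real" where
  "net_flow G f w =
     (\<Sum>d\<in>{d\<in>edges G. fst (ends G d) = w}. (f w - f (snd (ends G d))) / len G d) +
     (\<Sum>d\<in>{d\<in>edges G. snd (ends G d) = w}. (f w - f (fst (ends G d))) / len G d)"

definition voltage :: "('v, 'e) mgraph \<Rightarrow> 'v \<Rightarrow> 'v \<Rightarrow> 'v \<Rightarrow> real" where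
  "voltage G z x y =
     (THE f. f z = 0 \<and> (\<forall>w. w \<notin> verts G \<longrightarrow> f w = 0) \<and>
        (\<forall>w\<in>verts G. net_flow G f w =
            (if w = y then 1 else 0) - (if w = z then 1 else 0))) x"

definition eff_res :: "('v, 'e) mgraph \<Rightarrow> 'v \<Rightarrow> 'v \<Rightarrow> real" where
  "eff_res G a b = voltage G b a a"

definition is_bridge :: "('v, 'e) mgraph \<Rightarrow> 'e \<Rightarrow> bool" where
  "is_bridge G e \<longleftrightarrow> \<not> connected_graph (delete_edge G e)"

text \<open>The triple (R_i, R_{a_i,p}, R_{b_i,p}) for edge e and vertex p.  For a bridge it is
  given as a function of the parameter t = R_i (to be sent to infinity).\<close>
definition edge_data :: "('v, 'e) mgraph \<Rightarrow> 'e \<Rightarrow> 'v \<Rightarrow> real \<Rightarrow> real \<times> real \<times> real" where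
  "edge_data G e p t =
     (let H = delete_edge G e; pe = fst (ends G e); qe = snd (ends G e) in
      if is_bridge G e then
        (if reach H pe p then (t, 0, t) else (t, t, 0))
      else (eff_res H pe qe, voltage H pe p qe, voltage H qe p pe))"

definition eval_edge :: "('v, 'e) mgraph \<Rightarrow> 'e \<Rightarrow> 'v \<Rightarrow> (real \<times> real \<times> real \<Rightarrow> real) \<Rightarrow> real" where
  "eval_edge G e p F =
     (if is_bridge G e then Lim at_top (\<lambda>t. F (edge_data G e p t))
      else F (edge_data G e p 0))"

definition x_at :: "('v, 'e) mgraph \<Rightarrow> 'v \<Rightarrow> real" where
  "x_at G p =
     (\<Sum>e\<in>edges G. eval_edge G e p (\<lambda>(R, Ra, Rb). len G e ^ 2 * R / (len G e + R) ^ 2))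
     + 3/4 * (\<Sum>e\<in>edges G. eval_edge G e p (\<lambda>(R, Ra, Rb). len G e * R ^ 2 / (len G e + R) ^ 2))
     - 3/4 * (\<Sum>e\<in>edges G. eval_edge G e p
                  (\<lambda>(R, Ra, Rb). len G e * (Ra - Rb) ^ 2 / (len G e + R) ^ 2))"

definition y_at :: "('v, 'e) mgraph \<Rightarrow> 'v \<Rightarrow> real" where
  "y_at G p =
     1/4 * (\<Sum>e\<in>edges G. eval_edge G e p (\<lambda>(R, Ra, Rb). len G e * R ^ 2 / (len G e + R) ^ 2))
     + 3/4 * (\<Sum>e\<in>edges G. eval_edge G e p
                  (\<lambda>(R, Ra, Rb). len G e * (Ra - Rb) ^ 2 / (len G e + R) ^ 2))"

text \<open>The invariants are independent of the chosen vertex p; we use an arbitrary vertex.\<close>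
definition x_inv :: "('v, 'e) mgraph \<Rightarrow> real" where
  "x_inv G = x_at G (SOME p. p \<in> verts G)"

definition y_inv :: "('v, 'e) mgraph \<Rightarrow> real" where
  "y_inv G = y_at G (SOME p. p \<in> verts G)"

text \<open>The coefficient R_i / (L_i + R_i) (equal to 1 for a bridge, 0 for a self-loop).\<close>
definition coeff :: "('v, 'e) mgraph \<Rightarrow> 'e \<Rightarrow> real" where
  "coeff G e = eval_edge G e (SOME p. p \<in> verts G) (\<lambda>(R, Ra, Rb). R / (len G e + R))"

fun csum :: "(('v, 'e) mgraph \<Rightarrow> real) \<Rightarrow> nat \<Rightarrow> ('v, 'e) mgraph \<Rightarrow> real" where
  "csum F 0 G = F G"
| "csum F (Suc k) G = (\<Sum>e\<in>edges G. coeff G e * csum F k (contract G e))"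

end

theory Submission
  imports Defs "HOL-Real_Asymp.Real_Asymp"
begin

text \<open>
  Let \<open>g\<close> be the Green function of \<open>\<Gamma>\<close> grounded at \<open>p\<close>.  For an edge \<open>e\<close> with end points
  \<open>a, b\<close> write \<open>D\<^sub>e(x) = g(a,x) - g(b,x)\<close> and \<open>r\<^sub>e = D\<^sub>e(a) - D\<^sub>e(b)\<close>, the effective resistance
  between \<open>a\<close> and \<open>b\<close> in \<open>\<Gamma>\<close> itself, so that \<open>R\<^sub>e/(L\<^sub>e + R\<^sub>e) = r\<^sub>e/L\<^sub>e\<close>.  Then
  \<open>x + y = \<Sum>\<^sub>e r\<^sub>e\<close> and \<open>y = \<Sum>\<^sub>x g(x,x) - \<Sum>\<^sub>e (g(a,a) g(b,b) - g(a,b)\<^sup>2)/L\<^sub>e\<close>.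
  Contracting \<open>f\<close> replaces \<open>g(x,y)\<close> by \<open>g(x,y) - D\<^sub>f(x) D\<^sub>f(y)/r\<^sub>f\<close>, and after multiplication by
  \<open>r\<^sub>f\<close> the two-by-two minors become polynomial in \<open>g\<close>, \<open>D\<^sub>f\<close> and \<open>r\<^sub>f\<close>.  Foster's identity
  \<open>\<Sum>\<^sub>f r\<^sub>f/L\<^sub>f = v - 1\<close> and the energy identity \<open>\<Sum>\<^sub>f D\<^sub>f(x) D\<^sub>f(y)/L\<^sub>f = g(x,y)\<close> then evaluate the
  sum over \<open>f\<close>, which gives the case \<open>k = 1\<close>; the general case follows by iteration.
\<close>

section \<open>Dirichlet energy and solvability\<close>

text \<open>Gaussian elimination, by induction on the equations: one with a nonzero coefficient at
  \<open>x0\<close> eliminates that unknown from the others and is solved for it at the end. This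
  produces potentials later on.\<close>

lemma homogeneous_system_nontrivial:
  fixes A :: "'i \<Rightarrow> 'x \<Rightarrow> real"
  assumes "finite I" "finite X" "card I < card X"
  shows "\<exists>u. (\<exists>x\<in>X. u x \<noteq> 0) \<and> (\<forall>i\<in>I. (\<Sum>x\<in>X. A i x * u x) = 0)"
  using assms
proof (induction I arbitrary: X A rule: finite_induct)
  case empty
  then have "X \<noteq> {}" by auto
  then show ?case by (intro exI[of _ "\<lambda>_. 1"]) auto
next
  case (insert i I)
  show ?case
  proof (cases "\<forall>x\<in>X. A i x = 0")
    case True
    with insert.IH[of X A] insert.prems insert.hyps show ?thesis by auto
  next
    case False
    then obtain x0 where x0: "x0 \<in> X" "A i x0 \<noteq> 0" by auto
    define X' where "X' = X - {x0}"
    define A' where "A' = (\<lambda>j x. A j x - A j x0 * A i x / A i x0)"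
    have X: "X = insert x0 X'" "x0 \<notin> X'" "finite X'"
      using x0 insert.prems by (auto simp: X'_def)
    have "card I < card X'" using X insert.hyps insert.prems by simp
    from insert.IH[OF X(3) this, of A'] obtain u where
      u: "\<exists>x\<in>X'. u x \<noteq> 0" "\<And>j. j \<in> I \<Longrightarrow> (\<Sum>x\<in>X'. A' j x * u x) = 0" by blast
    define s where "s = - (\<Sum>x\<in>X'. A i x * u x) / A i x0"
    define u' where "u' = u(x0 := s)"
    have sum': "(\<Sum>x\<in>X. A j x * u' x) = A j x0 * s + (\<Sum>x\<in>X'. A j x * u x)" for j
    proof -
      have "(\<Sum>x\<in>X'. A j x * u' x) = (\<Sum>x\<in>X'. A j x * u x)"
        by (rule sum.cong) (use X in \<open>auto simp: u'_def\<close>)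
      then show ?thesis using X by (simp add: u'_def)
    qed
    have "(\<Sum>x\<in>X. A j x * u' x) = 0" if "j \<in> insert i I" for j
    proof (cases "j = i")
      case True
      then show ?thesis using x0 unfolding sum' s_def by simp
    next
      case False
      then have "(\<Sum>x\<in>X'. A' j x * u x) = 0" using that u by auto
      also have "(\<Sum>x\<in>X'. A' j x * u x) =
          (\<Sum>x\<in>X'. A j x * u x) - A j x0 / A i x0 * (\<Sum>x\<in>X'. A i x * u x)"
        by (simp add: A'_def sum_subtractf sum_distrib_left algebra_simps)
      finally show ?thesis unfolding sum' s_def using x0 by (simp add: field_simps)
    qed
    moreover have "\<exists>x\<in>X. u' x \<noteq> 0" using u(1) X by (auto simp: u'_def)
    ultimately show ?thesis by blast
  qed
qed

section \<open>The Dirichlet form and Kirchhoff's law in weak form\<close>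

definition energy :: "('v, 'e) mgraph \<Rightarrow> ('v \<Rightarrow> real) \<Rightarrow> ('v \<Rightarrow> real) \<Rightarrow> real" where
  "energy G h u = (\<Sum>e\<in>edges G. (h (fst (ends G e)) - h (snd (ends G e))) *
     (u (fst (ends G e)) - u (snd (ends G e))) / len G e)"

lemma energy_commute: "energy G h u = energy G u h"
  by (simp add: energy_def mult.commute)

lemma energy_add: "energy G h (\<lambda>x. u x + w x) = energy G h u + energy G h w"
  unfolding energy_def sum.distrib[symmetric]
  by (rule sum.cong) (auto simp: add_divide_distrib[symmetric] algebra_simps)

lemma energy_cmult: "energy G h (\<lambda>x. c * u x) = c * energy G h u"
  unfolding energy_def sum_distrib_left
  by (rule sum.cong) (auto simp: algebra_simps)

lemma energy_diff: "energy G h (\<lambda>x. u x - w x) = energy G h u - energy G h w"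
  using energy_add[of G h u "\<lambda>x. (-1) * w x"] energy_cmult[of G h "-1" w] by simp

lemma energy_const: "energy G h (\<lambda>x. c) = 0"
  by (simp add: energy_def)

lemma metrized_graphD:
  assumes "metrized_graph G"
  shows "finite (verts G)" "finite (edges G)" "verts G \<noteq> {}"
    and "e \<in> edges G \<Longrightarrow> fst (ends G e) \<in> verts G"
    and "e \<in> edges G \<Longrightarrow> snd (ends G e) \<in> verts G"
    and "e \<in> edges G \<Longrightarrow> len G e > 0"
    and "u \<in> verts G \<Longrightarrow> w \<in> verts G \<Longrightarrow> reach G u w"
  using assms by (auto simp: metrized_graph_def connected_graph_def)

lemma energy_cong:
  assumes "metrized_graph G" "\<And>x. x \<in> verts G \<Longrightarrow> h x = h' x" "\<And>x. x \<in> verts G \<Longrightarrow> u x = u' x"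
  shows "energy G h u = energy G h' u'"
  unfolding energy_def
  by (rule sum.cong) (use assms metrized_graphD[OF assms(1)] in auto)

text \<open>Summation by parts: regrouping the sum over vertices by edges meets every edge once from
  each end, with opposite currents.\<close>

lemma sum_mult_net_flow:
  assumes "metrized_graph G"
  shows "(\<Sum>w\<in>verts G. h w * net_flow G u w) = energy G h u"
proof -
  note G = metrized_graphD[OF assms]
  let ?a = "\<lambda>d. fst (ends G d)" and ?b = "\<lambda>d. snd (ends G d)"
  let ?i = "\<lambda>d. (u (?a d) - u (?b d)) / len G d"
  have 1: "(\<Sum>w\<in>verts G. \<Sum>d\<in>{d\<in>edges G. ?a d = w}. h (?a d) * ?i d) =
      (\<Sum>d\<in>edges G. h (?a d) * ?i d)"
    by (rule sum.group) (use G in auto)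
  have 2: "(\<Sum>w\<in>verts G. \<Sum>d\<in>{d\<in>edges G. ?b d = w}. h (?b d) * - ?i d) =
      (\<Sum>d\<in>edges G. h (?b d) * - ?i d)"
    by (rule sum.group) (use G in auto)
  have "(\<Sum>w\<in>verts G. h w * net_flow G u w) =
      (\<Sum>w\<in>verts G. \<Sum>d\<in>{d\<in>edges G. ?a d = w}. h (?a d) * ?i d) +
      (\<Sum>w\<in>verts G. \<Sum>d\<in>{d\<in>edges G. ?b d = w}. h (?b d) * - ?i d)"
    unfolding sum.distrib[symmetric] net_flow_def distrib_left sum_distrib_left
    by (intro sum.cong arg_cong2[where f = "(+)"] refl) (auto simp: minus_divide_left)
  also have "\<dots> = energy G h u"
    unfolding 1 2 sum.distrib[symmetric] energy_def
    by (rule sum.cong) (auto simp: algebra_simps diff_divide_distrib add_divide_distrib)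
  finally show ?thesis .
qed

lemma net_flow_eq_energy:
  assumes "metrized_graph G" "w \<in> verts G"
  shows "net_flow G u w = energy G (\<lambda>x. if x = w then 1 else 0) u"
proof -
  have "(\<Sum>x\<in>verts G. (if x = w then 1 else 0) * net_flow G u x) =
      (\<Sum>x\<in>verts G. if x = w then net_flow G u x else 0)"
    by (rule sum.cong) auto
  also have "\<dots> = net_flow G u w"
    using assms metrized_graphD(1)[OF assms(1)] by simp
  finally show ?thesis using sum_mult_net_flow[OF assms(1)] by metis
qed

text \<open>Summation by parts gives one direction, testing with indicator functions of vertices the
  other. From here on Kirchhoff's law appears only in the weak form on the right.\<close>

lemma net_flow_unit_iff:
  assumes G: "metrized_graph G" and y: "y \<in> verts G" and z: "z \<in> verts G"
  shows "(\<forall>w\<in>verts G. net_flow G u w = (if w = y then 1 else 0) - (if w = z then 1 else 0))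
    \<longleftrightarrow> (\<forall>h. energy G h u = h y - h z)" (is "?L \<longleftrightarrow> ?R")
proof
  assume L: ?L
  show ?R
  proof
    fix h
    have "energy G h u = (\<Sum>w\<in>verts G. (if w = y then h w else 0) - (if w = z then h w else 0))"
      unfolding sum_mult_net_flow[OF G, symmetric]
      by (rule sum.cong) (use L in auto)
    also have "\<dots> = h y - h z"
      using y z metrized_graphD(1)[OF G] by (simp add: sum_subtractf)
    finally show "energy G h u = h y - h z" .
  qed
next
  assume ?R
  then show ?L by (auto simp: net_flow_eq_energy[OF G])
qed

section \<open>Positivity, uniqueness and existence of potentials\<close>

lemma energy_nonneg: "metrized_graph G \<Longrightarrow> energy G u u \<ge> 0"
  unfolding energy_def by (intro sum_nonneg) (use metrized_graphD(6) in fastforce)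

lemma reach_invariant:
  assumes "reach G x y"
    and "\<And>d. d \<in> edges G \<Longrightarrow> u (fst (ends G d)) = u (snd (ends G d))"
  shows "u x = u y"
  using assms(1) unfolding reach_def
proof (induction rule: rtranclp_induct)
  case (step y z)
  then show ?case using assms(2) unfolding adj_def by fastforce
qed simp

lemma energy_zero_imp_const:
  assumes G: "metrized_graph G" and "energy G u u = 0" "x \<in> verts G" "y \<in> verts G"
  shows "u x = u y"
proof -
  have "\<forall>d\<in>edges G. (u (fst (ends G d)) - u (snd (ends G d))) *
      (u (fst (ends G d)) - u (snd (ends G d))) / len G d = 0"
    using assms(2) unfolding energy_def
    by (subst (asm) sum_nonneg_eq_0_iff)
      (use metrized_graphD[OF G] in \<open>auto intro!: divide_nonneg_pos\<close>)
  then have "u (fst (ends G d)) = u (snd (ends G d))" if "d \<in> edges G" for d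
    using that metrized_graphD(6)[OF G that] by auto
  then show ?thesis using reach_invariant metrized_graphD(7)[OF G] assms(3,4) by metis
qed

text \<open>The difference of two potentials for the same current has zero energy, so by
  connectedness it is constant on the vertices.\<close>

lemma potential_unique:
  assumes G: "metrized_graph G"
    and "\<And>h. energy G h u = h y - h z" "\<And>h. energy G h w = h y - h z"
    and "x \<in> verts G" "x' \<in> verts G"
  shows "u x - u x' = w x - w x'"
proof -
  have "energy G (\<lambda>t. u t - w t) (\<lambda>t. u t - w t) = 0"
    unfolding energy_diff assms(2,3) by simp
  from energy_zero_imp_const[OF G this assms(4,5)] show ?thesis by simp
qed

text \<open>The unknowns are the potentials off \<open>z\<close> together with the total current, which occupies
  the slot of the (zero) potential at \<open>z\<close>; the equation at \<open>z\<close> is redundant.\<close>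

lemma potential_exists:
  assumes G: "metrized_graph G" and y: "y \<in> verts G" and z: "z \<in> verts G"
  obtains u where "u z = 0" "\<And>w. w \<notin> verts G \<Longrightarrow> u w = 0" "\<And>h. energy G h u = h y - h z"
proof (cases "y = z")
  case True
  show ?thesis by (rule that[of "\<lambda>_. 0"]) (use True in \<open>auto simp: energy_const\<close>)
next
  case False
  note fin = metrized_graphD(1)[OF G]
  define \<delta> where "\<delta> = (\<lambda>w x :: 'a. if x = w then 1 else 0 :: real)"
  define A where "A = (\<lambda>w x. if x = z then - \<delta> y w else net_flow G (\<delta> w) x)"
  have "card (verts G - {z}) < card (verts G)" by (rule card_Diff1_less[OF fin z])
  then obtain s where s: "\<exists>x\<in>verts G. s x \<noteq> 0"
    and sol: "\<And>w. w \<in> verts G - {z} \<Longrightarrow> (\<Sum>x\<in>verts G. A w x * s x) = 0"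
    using homogeneous_system_nontrivial[of "verts G - {z}" "verts G" A] fin by blast
  define u where "u = (\<lambda>x. if x = z \<or> x \<notin> verts G then 0 else s x)"
  have flow: "energy G (\<delta> w) u = s z * \<delta> y w" if w: "w \<in> verts G - {z}" for w
  proof -
    have "energy G (\<delta> w) u = (\<Sum>x\<in>verts G. u x * net_flow G (\<delta> w) x)"
      by (simp add: energy_commute[of G "\<delta> w"] sum_mult_net_flow[OF G])
    also have "\<dots> = (\<Sum>x\<in>verts G. A w x * s x + (if x = z then \<delta> y w * s x else 0))"
      by (rule sum.cong) (auto simp: u_def A_def)
    also have "\<dots> = s z * \<delta> y w"
      using sol[OF w] z fin by (simp add: sum.distrib)
    finally show ?thesis .
  qed
  have en: "energy G h u = s z * (h y - h z)" for h
  proof -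
    have "energy G h u = energy G (\<lambda>x. h x - h z) u"
      by (simp add: energy_commute[of G _ u] energy_diff energy_const)
    also have "\<dots> = (\<Sum>w\<in>verts G. (h w - h z) * net_flow G u w)"
      by (simp add: sum_mult_net_flow[OF G])
    also have "\<dots> = (\<Sum>w\<in>verts G. if w = y then s z * (h w - h z) else 0)"
    proof (rule sum.cong)
      fix w assume w: "w \<in> verts G"
      show "(h w - h z) * net_flow G u w = (if w = y then s z * (h w - h z) else 0)"
      proof (cases "w = z")
        case True
        then show ?thesis using False by simp
      next
        case False
        then show ?thesis
          using flow[of w] w net_flow_eq_energy[OF G w, of u] by (simp add: \<delta>_def)
      qed
    qed simp
    also have "\<dots> = s z * (h y - h z)" using y fin by simp
    finally show ?thesis .
  qed
  \<comment> \<open>Division by the total current \<open>s z\<close> will normalise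
    \<open>u\<close>. If it were 0, \<open>u\<close> would have zero energy, hence vanish on all
    vertices, and \<open>s\<close> would be the trivial solution.\<close>
  have "s z \<noteq> 0"
  proof
    assume 0: "s z = 0"
    then have "energy G u u = 0" using en by simp
    then have const: "u x = u z" if "x \<in> verts G" for x
      using energy_zero_imp_const[OF G _ that z] by blast
    have "s x = 0" if "x \<in> verts G" for x
      using 0 const[OF that] that by (cases "x = z") (simp_all add: u_def)
    with s show False by blast
  qed
  show ?thesis
    by (rule that[of "\<lambda>x. inverse (s z) * u x"])
      (use \<open>s z \<noteq> 0\<close> in \<open>auto simp: u_def energy_cmult en[unfolded u_def]\<close>)
qed

text \<open>This removes the definite description in \<open>voltage\<close>: any weak solution
  \<open>u\<close> computes it, whatever its additive constant and its values off the graph.\<close>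

lemma voltage_eqI:
  assumes G: "metrized_graph G" and yz: "y \<in> verts G" "z \<in> verts G" and x: "x \<in> verts G"
    and u: "\<And>h. energy G h u = h y - h z"
  shows "voltage G z x y = u x - u z"
proof -
  obtain v where v: "v z = 0" "\<And>w. w \<notin> verts G \<Longrightarrow> v w = 0" "\<And>h. energy G h v = h y - h z"
    using potential_exists[OF G yz] by metis
  have "(THE f. f z = 0 \<and> (\<forall>w. w \<notin> verts G \<longrightarrow> f w = 0) \<and>
        (\<forall>w\<in>verts G. net_flow G f w = (if w = y then 1 else 0) - (if w = z then 1 else 0))) = v"
    unfolding net_flow_unit_iff[OF G yz]
  proof (rule the_equality)
    fix f assume f: "f z = 0 \<and> (\<forall>w. w \<notin> verts G \<longrightarrow> f w = 0) \<and> (\<forall>h. energy G h f = h y - h z)"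
    have "f w = v w" if "w \<in> verts G" for w
      using potential_unique[OF G, of f y z v w z] f v that yz by simp
    then show "f = v" using f v(2) by (metis ext)
  qed (use v in auto)
  then have "voltage G z x y = v x - v z" unfolding voltage_def using v(1) by simp
  also have "\<dots> = u x - u z" by (rule potential_unique[OF G v(3) u x yz(2)])
  finally show ?thesis .
qed

section \<open>Green kernels\<close>

text \<open>\<open>g x y\<close> is the potential at \<open>x\<close> for unit current from
  \<open>y\<close> to \<open>p\<close>. The kernel is a parameter, so that one theory serves
  \<open>G\<close>, its edge deletions, its contractions and changes of base point.\<close>

locale green_kernel =
  fixes G :: "('v, 'e) mgraph" and p :: 'v and g :: "'v \<Rightarrow> 'v \<Rightarrow> real"
  assumes graph: "metrized_graph G" and base: "p \<in> verts G"
    and ground: "y \<in> verts G \<Longrightarrow> g p y = 0"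
    and source: "y \<in> verts G \<Longrightarrow> energy G h (\<lambda>x. g x y) = h y - h p"

lemma green_kernel_exists:
  assumes G: "metrized_graph G" and p: "p \<in> verts G"
  obtains g where "green_kernel G p g"
proof -
  have "\<exists>u. u p = 0 \<and> (\<forall>h. energy G h u = h y - h p)" if "y \<in> verts G" for y
    using potential_exists[OF G that p] by metis
  then obtain f where "\<And>y. y \<in> verts G \<Longrightarrow> f y p = 0 \<and> (\<forall>h. energy G h (f y) = h y - h p)"
    by metis
  then have "green_kernel G p (\<lambda>x y. f y x)"
    using G p by unfold_locales auto
  with that show ?thesis .
qed

context green_kernel
begin

lemmas finite_verts = metrized_graphD(1)[OF graph]
lemmas ends_verts [simp] = metrized_graphD(4,5)[OF graph]
lemmas len_pos = metrized_graphD(6)[OF graph]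

abbreviation a :: "'e \<Rightarrow> 'v" where "a e \<equiv> fst (ends G e)"
abbreviation b :: "'e \<Rightarrow> 'v" where "b e \<equiv> snd (ends G e)"

definition drop :: "'e \<Rightarrow> 'v \<Rightarrow> real" where
  "drop e x = g (a e) x - g (b e) x"

definition res :: "'e \<Rightarrow> real" where
  "res e = drop e (a e) - drop e (b e)"

text \<open>Reciprocity: the energy of the potentials with sources \<open>x\<close> and
  \<open>y\<close> can be evaluated by \<open>source\<close> in either order.\<close>

lemma sym: "x \<in> verts G \<Longrightarrow> y \<in> verts G \<Longrightarrow> g x y = g y x"
  using source[of y "\<lambda>z. g z x"] source[of x "\<lambda>z. g z y"] ground
    energy_commute[of G "\<lambda>z. g z x" "\<lambda>z. g z y"] by simp

lemma kernel_unique: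
  assumes "green_kernel G p g'" "x \<in> verts G" "y \<in> verts G"
  shows "g x y = g' x y"
  using potential_unique[OF graph source[OF assms(3)] green_kernel.source[OF assms(1,3)] assms(2) base]
    ground green_kernel.ground[OF assms(1)] assms by simp

text \<open>The left side is the energy of the potentials with sources \<open>x\<close> and
  \<open>y\<close>, which the reproducing property \<open>source\<close> evaluates.\<close>

lemma sum_drop_drop:
  assumes "x \<in> verts G" "y \<in> verts G"
  shows "(\<Sum>e\<in>edges G. drop e x * drop e y / len G e) = g x y"
  using source[OF assms(2), of "\<lambda>z. g z x"] ground assms sym
  by (simp add: energy_def drop_def)

text \<open>By symmetry of \<open>g\<close>, \<open>drop e\<close> is also a potential: that of unit
  current entering at \<open>a e\<close> and leaving at \<open>b e\<close>.\<close>

lemma energy_drop: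
  assumes "e \<in> edges G"
  shows "energy G h (drop e) = h (a e) - h (b e)"
proof -
  have "energy G h (drop e) = energy G h (\<lambda>x. g x (a e) - g x (b e))"
    by (rule energy_cong[OF graph]) (use assms in \<open>auto simp: drop_def sym\<close>)
  then show ?thesis using assms by (simp add: energy_diff source)
qed

lemma res_eq: "e \<in> edges G \<Longrightarrow> res e = g (a e) (a e) + g (b e) (b e) - 2 * g (a e) (b e)"
  by (simp add: res_def drop_def sym)

lemma res_loop: "a e = b e \<Longrightarrow> res e = 0"
  by (simp add: res_def)

lemma drop_loop: "a e = b e \<Longrightarrow> drop e x = 0"
  by (simp add: drop_def)

text \<open>\<open>res e\<close> is the energy of \<open>drop e\<close>. If it vanished,
  \<open>drop e\<close> would be constant and could not carry unit current out of
  \<open>a e\<close>.\<close>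

lemma res_nonzero:
  assumes e: "e \<in> edges G" "a e \<noteq> b e"
  shows "res e \<noteq> 0"
proof
  assume "res e = 0"
  then have en: "energy G (drop e) (drop e) = 0" using e by (simp add: energy_drop res_def)
  define h where "h = (\<lambda>x. if x = a e then 1 else 0 :: real)"
  have "energy G h (drop e) = energy G h (\<lambda>_. drop e (a e))"
    by (rule energy_cong[OF graph refl]) (use e in \<open>auto intro: energy_zero_imp_const[OF graph en]\<close>)
  then show False using energy_drop[OF e(1), of h] e by (simp add: h_def energy_const)
qed

text \<open>The sum over \<open>x\<close> of \<open>h x\<close> times the current that \<open>g(\<cdot>, x)\<close> injects at \<open>x\<close> itself.\<close>

lemma sum_diagonal:
  "(\<Sum>e\<in>edges G. (h (a e) * drop e (a e) - h (b e) * drop e (b e)) / len G e) =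
    (\<Sum>x\<in>verts G. h x) - h p"
proof -
  let ?\<delta> = "\<lambda>w x :: 'v. if x = w then 1 else 0 :: real"
  have "(\<Sum>x\<in>verts G. h x * energy G (?\<delta> x) (\<lambda>z. g z x)) =
      (\<Sum>x\<in>verts G. h x - (if x = p then h x else 0))"
    by (rule sum.cong) (auto simp: source)
  also have "\<dots> = (\<Sum>x\<in>verts G. h x) - h p"
    using base finite_verts by (simp add: sum_subtractf)
  finally have rhs: "(\<Sum>x\<in>verts G. h x * energy G (?\<delta> x) (\<lambda>z. g z x)) =
    (\<Sum>x\<in>verts G. h x) - h p" .
  have "(\<Sum>x\<in>verts G. h x * energy G (?\<delta> x) (\<lambda>z. g z x)) =
      (\<Sum>e\<in>edges G. \<Sum>x\<in>verts G. h x * ((?\<delta> x (a e) - ?\<delta> x (b e)) * drop e x / len G e))"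
    unfolding energy_def sum_distrib_left drop_def by (rule sum.swap)
  also have "\<dots> = (\<Sum>e\<in>edges G. (h (a e) * drop e (a e) - h (b e) * drop e (b e)) / len G e)"
  proof (rule sum.cong)
    fix e assume e: "e \<in> edges G"
    have "(\<Sum>x\<in>verts G. h x * ((?\<delta> x (a e) - ?\<delta> x (b e)) * drop e x / len G e)) =
        (\<Sum>x\<in>verts G. (if x = a e then h x * drop e x / len G e else 0) -
          (if x = b e then h x * drop e x / len G e else 0))"
      by (rule sum.cong) auto
    also have "\<dots> = (h (a e) * drop e (a e) - h (b e) * drop e (b e)) / len G e"
      using e finite_verts by (simp add: sum_subtractf diff_divide_distrib)
    finally show "(\<Sum>x\<in>verts G. h x * ((?\<delta> x (a e) - ?\<delta> x (b e)) * drop e x / len G e)) =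
      (h (a e) * drop e (a e) - h (b e) * drop e (b e)) / len G e" .
  qed simp
  finally show ?thesis using rhs by simp
qed

text \<open>Every vertex other than \<open>p\<close> injects unit current into its own potential, so
  \<open>h = 1\<close> in \<open>sum_diagonal\<close> counts these vertices.\<close>

lemma foster: "(\<Sum>e\<in>edges G. res e / len G e) = real (card (verts G)) - 1"
  using sum_diagonal[of "\<lambda>_. 1"] by (simp add: res_def)

text \<open>Subtracting the potential with source \<open>q\<close> moves the sink from
  \<open>p\<close> to \<open>q\<close>; the terms constant in \<open>x\<close> restore the value 0
  at \<open>x = q\<close>.\<close>

lemma rebase:
  assumes q: "q \<in> verts G"
  shows "green_kernel G q (\<lambda>x y. g x y - g x q - g q y + g q q)"
proof
  fix y h assume y: "y \<in> verts G"
  have "energy G h (\<lambda>x. (g x y - g x q) + (g q q - g q y)) = h y - h q"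
    unfolding energy_add energy_diff energy_const source[OF y] source[OF q] by simp
  then show "energy G h (\<lambda>x. g x y - g x q - g q y + g q q) = h y - h q"
    by (simp add: algebra_simps)
qed (use graph q in auto)

end

section \<open>The invariants in terms of a Green kernel\<close>

lemma reach_sym: "reach G u w \<Longrightarrow> reach G w u"
proof -
  have "symp (adj G)" by (auto simp: symp_def adj_def)
  then show "reach G u w \<Longrightarrow> reach G w u"
    unfolding reach_def using symp_rtranclp by (metis sympD)
qed

lemma reach_trans: "reach G u w \<Longrightarrow> reach G w x \<Longrightarrow> reach G u x"
  unfolding reach_def by (rule rtranclp_trans)

lemma reach_edge: "d \<in> edges G \<Longrightarrow> reach G (fst (ends G d)) (snd (ends G d))"
  unfolding reach_def by (rule r_into_rtranclp) (auto simp: adj_def prod_eq_iff)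

text \<open>If the end points of \<open>e\<close> were still joined after deletion, that path could
  replace \<open>e\<close> in every walk, and the deleted graph would be connected.\<close>

lemma bridge_separates:
  assumes G: "metrized_graph G" and e: "is_bridge G e"
  shows "\<not> reach (delete_edge G e) (fst (ends G e)) (snd (ends G e))"
proof
  let ?H = "delete_edge G e"
  assume r: "reach ?H (fst (ends G e)) (snd (ends G e))"
  have edge: "reach ?H (fst (ends G d)) (snd (ends G d))" if "d \<in> edges G" for d
    using r reach_edge[of d ?H] that by (cases "d = e") (auto simp: delete_edge_def)
  have "reach ?H u w" if "reach G u w" for u w
    using that unfolding reach_def[of G]
  proof (induction rule: rtranclp_induct)
    case base
    then show ?case by (simp add: reach_def)
  next
    case (step w x)
    have "reach ?H w x"
      using step(2) edge reach_sym[of ?H] unfolding adj_def by fastforce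
    with step.IH show ?case by (rule reach_trans)
  qed
  then have "connected_graph ?H"
    using metrized_graphD(7)[OF G] by (auto simp: connected_graph_def delete_edge_def)
  with e show False by (simp add: is_bridge_def)
qed

lemma metrized_delete_edge:
  "metrized_graph G \<Longrightarrow> \<not> is_bridge G e \<Longrightarrow> metrized_graph (delete_edge G e)"
  by (auto simp: metrized_graph_def is_bridge_def delete_edge_def)

lemma energy_delete_edge:
  assumes "finite (edges G)" "e \<in> edges G"
  shows "energy G h u = energy (delete_edge G e) h u +
    (h (fst (ends G e)) - h (snd (ends G e))) *
    (u (fst (ends G e)) - u (snd (ends G e))) / len G e"
  unfolding energy_def by (subst sum.remove[OF assms]) (simp add: delete_edge_def)

context green_kernel
begin

text \<open>Reinserting \<open>e\<close> into the graph without it is a rank-one update of the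
  kernel, which translates the edge data there into the kernel \<open>g\<close> of the whole
  graph.\<close>

lemma nonbridge_edge_data:
  assumes e: "e \<in> edges G" and nb: "\<not> is_bridge G e"
  obtains R Ra Rb where "edge_data G e p t = (R, Ra, Rb)" "R \<ge> 0"
    "res e = len G e * R / (len G e + R)"
    "g (a e) (a e) - g (b e) (b e) = len G e * (Ra - Rb) / (len G e + R)"
proof -
  define H where "H = delete_edge G e"
  have H: "metrized_graph H" unfolding H_def by (rule metrized_delete_edge[OF graph nb])
  have HV: "verts H = verts G" and Hends: "ends H = ends G"
    by (auto simp: H_def delete_edge_def)
  obtain h where h: "green_kernel H p h"
    using green_kernel_exists[OF H] base HV by metis
  interpret h: green_kernel H p h by (rule h)
  define A B where "A = a e" and "B = b e"
  have AB: "A \<in> verts G" "B \<in> verts G" using e by (auto simp: A_def B_def)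
  define L where "L = len G e"
  have L: "L > 0" using e len_pos by (simp add: L_def)
  define D where "D = (\<lambda>x. h x A - h x B)"
  define R where "R = D A - D B"
  \<comment> \<open>Since \<open>h\<close> vanishes at \<open>p\<close>, these are the voltages at
    \<open>p\<close> for unit current from \<open>B\<close> to \<open>A\<close>, measured against
    \<open>A\<close>, and from \<open>A\<close> to \<open>B\<close>, measured against
    \<open>B\<close>.\<close>
  define Ra Rb where "Ra = h A A - h A B" and "Rb = h B B - h A B"
  have hs: "h x y = h y x" if "x \<in> verts G" "y \<in> verts G" for x y
    using h.sym that HV by simp
  have D: "energy H \<phi> D = \<phi> A - \<phi> B" for \<phi>
    unfolding D_def energy_diff using h.source AB HV by simp
  have R0: "R \<ge> 0" using energy_nonneg[OF H, of D] D by (simp add: R_def)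
  have LR: "L + R \<noteq> 0" using L R0 by simp
  have RR: "R = Ra + Rb" "D A = Ra" "D B = - Rb"
    using hs[OF AB] by (auto simp: R_def D_def Ra_def Rb_def)
  have D': "energy H \<phi> (\<lambda>x. h x B - h x A) = \<phi> B - \<phi> A" for \<phi>
    unfolding energy_diff using h.source AB HV by simp
  have data: "edge_data G e p t = (R, Ra, Rb)"
    using nb voltage_eqI[OF H, of A B A D] voltage_eqI[OF H, of B A p "\<lambda>x. h x B - h x A"]
      voltage_eqI[OF H, of A B p D] D D' h.ground AB base HV hs[OF AB]
    by (simp add: edge_data_def H_def[symmetric] A_def[symmetric] B_def[symmetric] eff_res_def
        Let_def R_def Ra_def Rb_def D_def)
  \<comment> \<open>The current \<open>i\<close> that the reinserted edge draws from
    \<open>A\<close> to \<open>B\<close> satisfies \<open>D y - i * R = L * i\<close>, hence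
    \<open>i = D y / (L + R)\<close>; drawing it changes the potential by
    \<open>- i * D x\<close>.\<close>
  define g' where "g' = (\<lambda>x y. h x y - D y / (L + R) * D x)"
  have "green_kernel G p g'"
  proof
    fix y assume y: "y \<in> verts G"
    show "g' p y = 0" using h.ground y AB HV by (simp add: g'_def D_def)
    fix \<phi>
    have Dy: "D y = h A y - h B y" using hs y AB by (simp add: D_def)
    have "energy G \<phi> (\<lambda>x. g' x y) =
        (\<phi> y - \<phi> p - D y / (L + R) * (\<phi> A - \<phi> B)) +
        (\<phi> A - \<phi> B) * (g' A y - g' B y) / L"
      unfolding energy_delete_edge[OF metrized_graphD(2)[OF graph] e, folded H_def A_def B_def L_def]
      using h.source[of y \<phi>] y HV
      by (simp only: g'_def energy_diff energy_cmult D simp_thms)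
    also have "g' A y - g' B y = L * (D y / (L + R))"
    proof -
      have "g' A y - g' B y = D y - D y / (L + R) * (D A - D B)"
        unfolding g'_def right_diff_distrib using Dy by simp
      also have "\<dots> = L * (D y / (L + R))"
        unfolding R_def[symmetric] using LR by (simp add: field_simps)
      finally show ?thesis .
    qed
    finally show "energy G \<phi> (\<lambda>x. g' x y) = \<phi> y - \<phi> p"
      using L by simp
  qed (use graph base in auto)
  from kernel_unique[OF this]
  have g: "g x y = g' x y" if "x \<in> verts G" "y \<in> verts G" for x y using that .
  have gAB: "g A A = h A A - Ra * Ra / (L + R)" "g B B = h B B - Rb * Rb / (L + R)"
      "g A B = h A B + Ra * Rb / (L + R)"
    using g AB RR(2,3) by (simp_all add: g'_def)
  show ?thesis
  proof (rule that[OF data R0])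
    have "res e = R - (Ra * Ra + Rb * Rb + 2 * (Ra * Rb)) / (L + R)"
      unfolding res_eq[OF e, folded A_def B_def] gAB RR(1) add_divide_distrib Ra_def Rb_def
      by simp
    also have "Ra * Ra + Rb * Rb + 2 * (Ra * Rb) = R * R"
      unfolding RR(1) by (simp add: algebra_simps)
    also have "R - R * R / (L + R) = L * R / (L + R)"
      using LR by (simp add: field_simps)
    finally show "res e = len G e * R / (len G e + R)" by (simp add: L_def)
    have "g A A - g B B = (Ra - Rb) - (Ra * Ra - Rb * Rb) / (L + R)"
      unfolding gAB diff_divide_distrib by (simp add: Ra_def Rb_def)
    also have "Ra * Ra - Rb * Rb = (Ra - Rb) * R"
      unfolding RR(1) by (simp add: algebra_simps)
    also have "(Ra - Rb) - (Ra - Rb) * R / (L + R) = L * (Ra - Rb) / (L + R)"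
      using LR by (simp add: field_simps)
    finally show "g (a e) (a e) - g (b e) (b e) = len G e * (Ra - Rb) / (len G e + R)"
      by (simp add: A_def B_def L_def)
  qed
qed

text \<open>Current between the ends of a bridge uses no other edge, so its potential is the length
  on the side of \<open>a e\<close> and 0 on the other. The side of \<open>p\<close> only decides
  the sign of the difference squared here.\<close>

lemma bridge_edge_data:
  assumes e: "e \<in> edges G" and br: "is_bridge G e"
  shows "res e = len G e" "(g (a e) (a e) - g (b e) (b e))\<^sup>2 = (len G e)\<^sup>2"
proof -
  define H where "H = delete_edge G e"
  define u where "u = (\<lambda>x. if reach H (a e) x then len G e else 0)"
  have ua: "u (a e) = len G e" by (simp add: u_def reach_def)
  have ub: "u (b e) = 0" using bridge_separates[OF graph br] by (simp add: u_def H_def)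
  have "u (fst (ends H d)) = u (snd (ends H d))" if "d \<in> edges H" for d
    unfolding u_def using reach_edge[OF that] reach_sym reach_trans by metis
  then have "energy H h u = 0" for h by (simp add: energy_def)
  then have en: "energy G h u = h (a e) - h (b e)" for h
    using energy_delete_edge[OF metrized_graphD(2)[OF graph] e, of h u] ua ub len_pos[OF e]
    by (simp add: H_def)
  have "drop e p = 0"
    using e by (simp add: drop_def sym[OF _ base] ground)
  then have d: "drop e x = u x - u p" if "x \<in> verts G" for x
    using potential_unique[OF graph energy_drop[OF e] en that base] by simp
  show "res e = len G e" using d ua ub e by (simp add: res_def)
  have "g (a e) (a e) - g (b e) (b e) = drop e (a e) + drop e (b e)"
    using sym e by (simp add: drop_def)
  also have "\<dots> = len G e - 2 * u p" using d ua ub e by simp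
  finally have "g (a e) (a e) - g (b e) (b e) = len G e - 2 * u p" .
  moreover have "u p = 0 \<or> u p = len G e" by (simp add: u_def)
  ultimately show "(g (a e) (a e) - g (b e) (b e))\<^sup>2 = (len G e)\<^sup>2" by auto
qed

text \<open>The two limits cover the two sides of the bridge on which \<open>p\<close> may
  lie.\<close>

lemma eval_bridge:
  assumes "is_bridge G e" "((\<lambda>t. F (t, 0, t)) \<longlongrightarrow> l) at_top" "((\<lambda>t. F (t, t, 0)) \<longlongrightarrow> l) at_top"
  shows "eval_edge G e p F = l"
  using assms unfolding eval_edge_def edge_data_def Let_def
  by (cases "reach (delete_edge G e) (a e) p") (auto intro!: tendsto_Lim)

section \<open>The edge summands expressed by \<open>res\<close> and \<open>g\<close>\<close>

lemma eval_coeff: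
  assumes e: "e \<in> edges G"
  shows "eval_edge G e p (\<lambda>(R, Ra, Rb). R / (len G e + R)) = res e / len G e"
proof (cases "is_bridge G e")
  case True
  have "((\<lambda>t. t / (len G e + t)) \<longlongrightarrow> 1) at_top" by real_asymp
  then have "eval_edge G e p (\<lambda>(R, Ra, Rb). R / (len G e + R)) = 1"
    by (intro eval_bridge[OF True]) simp_all
  then show ?thesis using bridge_edge_data[OF e True] len_pos[OF e] by simp
next
  case False
  obtain R Ra Rb where R: "edge_data G e p 0 = (R, Ra, Rb)" "R \<ge> 0"
    "res e = len G e * R / (len G e + R)"
    using nonbridge_edge_data[OF e False] by metis
  show ?thesis unfolding eval_edge_def R(1) using False R len_pos[OF e] by simp
qed

lemma eval_x1:
  assumes e: "e \<in> edges G"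
  shows "eval_edge G e p (\<lambda>(R, Ra, Rb). len G e ^ 2 * R / (len G e + R) ^ 2) =
    res e - (res e)\<^sup>2 / len G e"
proof (cases "is_bridge G e")
  case True
  have "((\<lambda>t. len G e ^ 2 * t / (len G e + t) ^ 2) \<longlongrightarrow> 0) at_top" by real_asymp
  then have "eval_edge G e p (\<lambda>(R, Ra, Rb). len G e ^ 2 * R / (len G e + R) ^ 2) = 0"
    by (intro eval_bridge[OF True]) simp_all
  then show ?thesis using bridge_edge_data[OF e True] len_pos[OF e] by (simp add: power2_eq_square)
next
  case False
  obtain R Ra Rb where R: "edge_data G e p 0 = (R, Ra, Rb)" "R \<ge> 0"
    "res e = len G e * R / (len G e + R)"
    using nonbridge_edge_data[OF e False] by metis
  \<comment> \<open>In this variable the summand is \<open>len G e * q * (1 - q)\<close>, while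
    \<open>res e = len G e * q\<close>.\<close>
  define q where "q = R / (len G e + R)"
  have "len G e / (len G e + R) = 1 - q"
    unfolding q_def using R(2) len_pos[OF e] by (simp add: field_simps)
  then have "len G e ^ 2 * R / (len G e + R) ^ 2 = len G e * q * (1 - q)"
    unfolding q_def by (metis (no_types, lifting) power2_eq_square times_divide_eq_left
        times_divide_eq_right times_divide_times_eq mult.commute mult.assoc)
  moreover have "res e = len G e * q" using R(3) by (simp add: q_def)
  ultimately show ?thesis unfolding eval_edge_def R(1) using False len_pos[OF e]
    by (simp add: power2_eq_square algebra_simps)
qed

lemma eval_xy2:
  assumes e: "e \<in> edges G"
  shows "eval_edge G e p (\<lambda>(R, Ra, Rb). len G e * R ^ 2 / (len G e + R) ^ 2) =
    (res e)\<^sup>2 / len G e"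
proof (cases "is_bridge G e")
  case True
  have "((\<lambda>t. len G e * t ^ 2 / (len G e + t) ^ 2) \<longlongrightarrow> len G e) at_top"
    using len_pos[OF e] by real_asymp
  then have "eval_edge G e p (\<lambda>(R, Ra, Rb). len G e * R ^ 2 / (len G e + R) ^ 2) = len G e"
    by (intro eval_bridge[OF True]) simp_all
  then show ?thesis using bridge_edge_data[OF e True] len_pos[OF e] by (simp add: power2_eq_square)
next
  case False
  obtain R Ra Rb where R: "edge_data G e p 0 = (R, Ra, Rb)" "R \<ge> 0"
    "res e = len G e * R / (len G e + R)"
    using nonbridge_edge_data[OF e False] by metis
  then show ?thesis unfolding eval_edge_def R(1) using False len_pos[OF e]
    by (simp add: power_divide power_mult_distrib) (simp add: power2_eq_square)
qed

lemma eval_xy3: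
  assumes e: "e \<in> edges G"
  shows "eval_edge G e p (\<lambda>(R, Ra, Rb). len G e * (Ra - Rb) ^ 2 / (len G e + R) ^ 2) =
    (g (a e) (a e) - g (b e) (b e))\<^sup>2 / len G e"
proof (cases "is_bridge G e")
  case True
  have "((\<lambda>t. len G e * (0 - t) ^ 2 / (len G e + t) ^ 2) \<longlongrightarrow> len G e) at_top"
    "((\<lambda>t. len G e * (t - 0) ^ 2 / (len G e + t) ^ 2) \<longlongrightarrow> len G e) at_top"
    using len_pos[OF e] by real_asymp+
  then have "eval_edge G e p (\<lambda>(R, Ra, Rb). len G e * (Ra - Rb) ^ 2 / (len G e + R) ^ 2) = len G e"
    by (intro eval_bridge[OF True]) simp_all
  then show ?thesis using bridge_edge_data[OF e True] len_pos[OF e] by (simp add: power2_eq_square)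
next
  case False
  obtain R Ra Rb where R: "edge_data G e p 0 = (R, Ra, Rb)" "R \<ge> 0"
    "g (a e) (a e) - g (b e) (b e) = len G e * (Ra - Rb) / (len G e + R)"
    using nonbridge_edge_data[OF e False] by metis
  have "len G e + R > 0" using R len_pos[OF e] by simp
  then show ?thesis unfolding eval_edge_def R(1) using False R(3) len_pos[OF e]
    by (simp add: power_divide power_mult_distrib) (simp add: power2_eq_square)
qed

section \<open>Closed forms of the invariants and independence of the base point\<close>

lemma y_at_eq_sum:
  "y_at G p = 1/4 * (\<Sum>e\<in>edges G. (res e)\<^sup>2 / len G e) +
    3/4 * (\<Sum>e\<in>edges G. (g (a e) (a e) - g (b e) (b e))\<^sup>2 / len G e)"
  unfolding y_at_def by (simp add: eval_xy2 eval_xy3 cong: sum.cong)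

text \<open>In the sum of both invariants the terms in \<open>Ra - Rb\<close> cancel, and the
  squares of \<open>res e\<close> have total coefficient -1 + 3/4 + 1/4 = 0.\<close>

lemma x_at_eq: "x_at G p = (\<Sum>e\<in>edges G. res e) - y_at G p"
  unfolding y_at_eq_sum unfolding x_at_def
  by (simp add: eval_x1 eval_xy2 eval_xy3 sum_subtractf cong: sum.cong)

definition minor :: "'e \<Rightarrow> real" where
  "minor e = g (a e) (a e) * g (b e) (b e) - (g (a e) (b e))\<^sup>2"

text \<open>With \<open>A = g(a,a)\<close>, \<open>B = g(b,b)\<close>, \<open>C = g(a,b)\<close> this rests on
  \<open>3/4 (A - B)\<^sup>2 + 1/4 (A + B - 2 C)\<^sup>2 = A (A - C) + B (B - C) - (A B - C\<^sup>2)\<close>.\<close>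

lemma y_at_eq:
  "y_at G p = (\<Sum>x\<in>verts G. g x x) - (\<Sum>e\<in>edges G. minor e / len G e)"
proof -
  have "y_at G p + (\<Sum>e\<in>edges G. minor e / len G e) =
      (\<Sum>e\<in>edges G. 1/4 * ((res e)\<^sup>2 / len G e) +
        3/4 * ((g (a e) (a e) - g (b e) (b e))\<^sup>2 / len G e) + minor e / len G e)"
    unfolding y_at_eq_sum sum.distrib sum_distrib_left ..
  also have "\<dots> = (\<Sum>e\<in>edges G.
      (g (a e) (a e) * drop e (a e) - g (b e) (b e) * drop e (b e)) / len G e)"
  proof (rule sum.cong)
    fix e assume e: "e \<in> edges G"
    have "1/4 * (res e)\<^sup>2 + 3/4 * (g (a e) (a e) - g (b e) (b e))\<^sup>2 + minor e =
        g (a e) (a e) * drop e (a e) - g (b e) (b e) * drop e (b e)"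
      using sym e unfolding res_eq[OF e] minor_def drop_def
      by (simp add: power2_eq_square field_simps)
    from arg_cong[OF this, of "\<lambda>t. t / len G e"]
    show "1/4 * ((res e)\<^sup>2 / len G e) + 3/4 * ((g (a e) (a e) - g (b e) (b e))\<^sup>2 / len G e) +
        minor e / len G e =
      (g (a e) (a e) * drop e (a e) - g (b e) (b e) * drop e (b e)) / len G e"
      by (simp add: add_divide_distrib)
  qed simp
  also have "\<dots> = (\<Sum>x\<in>verts G. g x x)"
    using sum_diagonal[of "\<lambda>x. g x x"] ground base by simp
  finally show ?thesis by simp
qed

text \<open>Rebasing keeps \<open>res\<close> and turns \<open>?A e\<close> into
  \<open>?A e - 2 * ?d e\<close>. After squaring, the two correction sums are -4 and 4 times
  energies that both equal \<open>g q q\<close>.\<close>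

lemma y_at_base_change:
  assumes q: "q \<in> verts G"
  shows "y_at G q = y_at G p" "x_at G q = x_at G p"
proof -
  interpret q: green_kernel G q "\<lambda>x y. g x y - g x q - g q y + g q q" by (rule rebase[OF q])
  have res: "q.res e = res e" if "e \<in> edges G" for e
    by (simp add: q.res_def res_def q.drop_def drop_def)
  let ?A = "\<lambda>e. g (a e) (a e) - g (b e) (b e)"
  let ?d = "\<lambda>e. g (a e) q - g (b e) q"
  have "(\<Sum>e\<in>edges G. (g (a e) (a e) - g (a e) q - g q (a e) + g q q -
          (g (b e) (b e) - g (b e) q - g q (b e) + g q q))\<^sup>2 / len G e) =
      (\<Sum>e\<in>edges G. (?A e)\<^sup>2 / len G e - 4 * (?A e * ?d e / len G e) + 4 * (?d e * ?d e / len G e))"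
  proof (rule sum.cong)
    fix e assume e: "e \<in> edges G"
    have "(g (a e) (a e) - g (a e) q - g q (a e) + g q q -
          (g (b e) (b e) - g (b e) q - g q (b e) + g q q))\<^sup>2 = (?A e)\<^sup>2 - 4 * (?A e * ?d e) + 4 * (?d e * ?d e)"
      using sym[OF q] e by (simp add: power2_eq_square algebra_simps)
    then show "(g (a e) (a e) - g (a e) q - g q (a e) + g q q -
          (g (b e) (b e) - g (b e) q - g q (b e) + g q q))\<^sup>2 / len G e =
       (?A e)\<^sup>2 / len G e - 4 * (?A e * ?d e / len G e) + 4 * (?d e * ?d e / len G e)"
      by (simp add: add_divide_distrib diff_divide_distrib)
  qed simp
  also have "\<dots> = (\<Sum>e\<in>edges G. (?A e)\<^sup>2 / len G e) - 4 * energy G (\<lambda>x. g x x) (\<lambda>x. g x q) +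
      4 * energy G (\<lambda>x. g x q) (\<lambda>x. g x q)"
    unfolding energy_def sum.distrib sum_subtractf sum_distrib_left ..
  also have "\<dots> = (\<Sum>e\<in>edges G. (?A e)\<^sup>2 / len G e)"
    using source[OF q] ground base q by simp
  finally show y: "y_at G q = y_at G p"
    unfolding y_at_eq_sum q.y_at_eq_sum by (simp add: res cong: sum.cong)
  show "x_at G q = x_at G p" unfolding x_at_eq q.x_at_eq y by (simp add: res cong: sum.cong)
qed

lemma some_vert: "(SOME q. q \<in> verts G) \<in> verts G"
  using base by (rule someI)

lemma y_inv_eq: "y_inv G = y_at G p" and x_inv_eq: "x_inv G = x_at G p"
  unfolding y_inv_def x_inv_def by (rule y_at_base_change[OF some_vert])+

lemma coeff_eq:
  assumes "e \<in> edges G"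
  shows "coeff G e = res e / len G e"
proof -
  let ?q = "SOME q. q \<in> verts G"
  interpret q: green_kernel G ?q "\<lambda>x y. g x y - g x ?q - g ?q y + g ?q ?q"
    by (rule rebase[OF some_vert])
  have "q.res e = res e" by (simp add: q.res_def res_def q.drop_def drop_def)
  then show ?thesis using q.eval_coeff[OF assms] by (simp add: coeff_def)
qed

end

section \<open>Contracting an edge\<close>

lemma contract_simps:
  "verts (contract G f) = (\<lambda>w. if w = snd (ends G f) then fst (ends G f) else w) ` verts G"
  "edges (contract G f) = edges G - {f}"
  "ends (contract G f) d = map_prod (\<lambda>w. if w = snd (ends G f) then fst (ends G f) else w)
     (\<lambda>w. if w = snd (ends G f) then fst (ends G f) else w) (ends G d)"
  "len (contract G f) = len G"
  by (simp_all add: contract_def Let_def)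

lemma metrized_contract:
  assumes G: "metrized_graph G"
  shows "metrized_graph (contract G f)"
proof -
  let ?c = "\<lambda>w. if w = snd (ends G f) then fst (ends G f) else w"
  have edge: "reach (contract G f) (?c (fst (ends G d))) (?c (snd (ends G d)))" if "d \<in> edges G" for d
  proof (cases "d = f")
    case True
    then show ?thesis by (simp add: reach_def)
  next
    case False
    then show ?thesis using reach_edge[of d "contract G f"] that by (simp add: contract_simps)
  qed
  have "reach (contract G f) (?c u) (?c w)" if "reach G u w" for u w
    using that unfolding reach_def[of G]
  proof (induction rule: rtranclp_induct)
    case base
    then show ?case by (simp add: reach_def)
  next
    case (step w x)
    have "reach (contract G f) (?c w) (?c x)"
      using step(2) edge reach_sym[of "contract G f"] unfolding adj_def by (metis fst_conv snd_conv)
    with step.IH show ?case by (rule reach_trans)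
  qed
  then have "connected_graph (contract G f)"
    using metrized_graphD(7)[OF G] unfolding connected_graph_def contract_simps(1) by blast
  then show ?thesis
    using metrized_graphD(1-6)[OF G]
    unfolding metrized_graph_def contract_simps fst_map_prod snd_map_prod by blast
qed

lemma verts_contract:
  assumes "f \<in> edges G" "metrized_graph G" "fst (ends G f) \<noteq> snd (ends G f)"
  shows "verts (contract G f) = verts G - {snd (ends G f)}"
  using assms metrized_graphD(4)[OF assms(2,1)] by (auto simp: contract_simps image_iff)

context green_kernel
begin

text \<open>The correction removes the potential drop along \<open>f\<close>: the new kernel agrees
  at \<open>a f\<close> and \<open>b f\<close> and so descends to the quotient. Test functions on
  the quotient also agree there, hence do not see the correction.\<close>

lemma contract_kernel:
  assumes f: "f \<in> edges G" and nl: "a f \<noteq> b f"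
  shows "green_kernel (contract G f) (if p = b f then a f else p)
    (\<lambda>x y. g x y - drop f y / res f * drop f x)"
proof -
  let ?c = "\<lambda>w. if w = b f then a f else w"
  let ?g = "\<lambda>x y. g x y - drop f y / res f * drop f x"
  note V = verts_contract[OF f graph nl]
  have r: "res f \<noteq> 0" by (rule res_nonzero[OF f nl])
  have dp: "drop f p = 0"
    using f by (simp add: drop_def sym[OF _ base] ground)
  have fib: "?g (?c x) y = ?g x y" for x y
  proof -
    have "drop f y / res f * drop f (a f) - drop f y / res f * drop f (b f) = drop f y"
      using r unfolding right_diff_distrib[symmetric] res_def[symmetric] by simp
    then show ?thesis by (auto simp: drop_def[of f y])
  qed
  show ?thesis
  proof
    show "metrized_graph (contract G f)" by (rule metrized_contract[OF graph])
    show "?c p \<in> verts (contract G f)" using base by (auto simp: contract_simps)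
  next
    fix y assume y: "y \<in> verts (contract G f)"
    then have y': "y \<in> verts G" "y \<noteq> b f" using V by auto
    show "?g (?c p) y = 0" unfolding fib using ground y' dp by simp
    fix h
    have "energy (contract G f) h (\<lambda>x. ?g x y) =
      (\<Sum>d\<in>edges G - {f}. (h (?c (a d)) - h (?c (b d))) * (?g (?c (a d)) y - ?g (?c (b d)) y) / len G d)"
      by (simp only: energy_def contract_simps fst_map_prod snd_map_prod)
    \<comment> \<open>The term of \<open>f\<close> can be put back because its end points have the
      same image.\<close>
    also have "\<dots> = (\<Sum>d\<in>edges G. (h (?c (a d)) - h (?c (b d))) * (?g (a d) y - ?g (b d) y) / len G d)"
      unfolding fib using metrized_graphD(2)[OF graph]
      by (intro sum.mono_neutral_left) auto
    also have "\<dots> = energy G (\<lambda>x. h (?c x)) (\<lambda>x. ?g x y)" by (simp only: energy_def)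
    also have "\<dots> = h (?c y) - h (?c p) - drop f y / res f * (h (?c (a f)) - h (?c (b f)))"
      by (simp only: energy_diff energy_cmult source[OF y'(1)] energy_drop[OF f])
    also have "\<dots> = h y - h (?c p)" using y' by simp
    finally show "energy (contract G f) h (\<lambda>x. ?g x y) = h y - h (?c p)" .
  qed
qed

text \<open>The factor \<open>res f\<close> in \<open>coeff\<close> clears the denominators of the
  contracted kernel. All sums are written over \<open>G\<close> itself, so they can be exchanged
  with a sum over \<open>f\<close>; for a self-loop both sides are 0.\<close>

lemma contract_step:
  assumes f: "f \<in> edges G"
  shows "coeff G f * y_inv (contract G f) =
      ((\<Sum>x\<in>verts G. res f * g x x - drop f x * drop f x) - minor f
       - (\<Sum>e\<in>edges G. (res f * minor e - g (a e) (a e) * (drop f (b e) * drop f (b e))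
          - g (b e) (b e) * (drop f (a e) * drop f (a e))
          + 2 * g (a e) (b e) * (drop f (a e) * drop f (b e))) / len G e)) / len G f" (is ?Y)
    and "coeff G f * (x_inv (contract G f) + y_inv (contract G f)) =
      (\<Sum>e\<in>edges G. res f * res e - (drop f (a e) - drop f (b e)) * (drop f (a e) - drop f (b e))) /
      len G f" (is ?XY)
proof -
  have "?Y \<and> ?XY"
  proof (cases "a f = b f")
    case True
    then show ?thesis
      by (simp add: coeff_eq[OF f] res_loop drop_loop minor_def power2_eq_square)
  next
    case nl: False
    let ?c = "\<lambda>w. if w = b f then a f else w"
    define g' where "g' = (\<lambda>x y. g x y - drop f y / res f * drop f x)"
    interpret c: green_kernel "contract G f" "?c p" g'
      unfolding g'_def by (rule contract_kernel[OF f nl])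
    have r: "res f \<noteq> 0" by (rule res_nonzero[OF f nl])
    have fib1: "g' (?c x) y = g' x y" for x y
    proof -
      have "drop f y / res f * drop f (a f) - drop f y / res f * drop f (b f) = drop f y"
        using r unfolding right_diff_distrib[symmetric] res_def[symmetric] by simp
      then show ?thesis by (auto simp: g'_def drop_def[of f y])
    qed
    have fib: "g' (?c x) (?c y) = g' x y" if "x \<in> verts G" "y \<in> verts G" for x y
    proof -
      have s: "g' x y = g' y x" if "x \<in> verts G" "y \<in> verts G" for x y
        using that by (simp add: g'_def sym mult.commute)
      have cy: "?c y \<in> verts G" using that f by simp
      have "g' (?c x) (?c y) = g' x (?c y)" by (rule fib1)
      also have "\<dots> = g' (?c y) x" by (rule s[OF that(1) cy])
      also have "\<dots> = g' y x" by (rule fib1)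
      also have "\<dots> = g' x y" by (rule s[OF that(2,1)])
      finally show ?thesis .
    qed
    have rg: "res f * g' x y = res f * g x y - drop f x * drop f y" for x y
      using r by (simp add: g'_def right_diff_distrib)
    have rs: "c.res e = g' (a e) (a e) - g' (b e) (a e) - (g' (a e) (b e) - g' (b e) (b e))"
      if "e \<in> edges G" for e
      unfolding c.res_def c.drop_def contract_simps fst_map_prod snd_map_prod
      using fib that by simp
    have res': "res f * c.res e =
        res f * res e - (drop f (a e) - drop f (b e)) * (drop f (a e) - drop f (b e))"
      if "e \<in> edges G" for e
      unfolding rs[OF that] right_diff_distrib rg res_def[of e] drop_def[of e] by (simp add: algebra_simps)
    have mn: "c.minor e = g' (a e) (a e) * g' (b e) (b e) - (g' (a e) (b e))\<^sup>2" if "e \<in> edges G" for e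
      unfolding c.minor_def contract_simps fst_map_prod snd_map_prod
      using fib that by simp
    \<comment> \<open>The terms of order \<open>1 / (res f)\<^sup>2\<close> cancel in the
      determinant, so a single factor \<open>res f\<close> suffices.\<close>
    have minor': "res f * c.minor e =
        res f * minor e - g (a e) (a e) * (drop f (b e) * drop f (b e))
          - g (b e) (b e) * (drop f (a e) * drop f (a e))
          + 2 * g (a e) (b e) * (drop f (a e) * drop f (b e))" if "e \<in> edges G" for e
    proof -
      have "res f * (g' (a e) (a e) * g' (b e) (b e) - (g' (a e) (b e))\<^sup>2) =
        res f * minor e - g (a e) (a e) * (drop f (b e) * drop f (b e))
          - g (b e) (b e) * (drop f (a e) * drop f (a e))
          + 2 * g (a e) (b e) * (drop f (a e) * drop f (b e))"
        unfolding minor_def g'_def using r by (simp add: field_simps power2_eq_square)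
      then show ?thesis by (simp only: mn[OF that])
    qed
    \<comment> \<open>The contracted end map makes \<open>f\<close> a loop, so including it in the
      edge sums adds 0.\<close>
    have minor0: "c.minor f = 0" and res0: "c.res f = 0"
      unfolding c.minor_def by (simp_all add: contract_simps c.res_loop power2_eq_square)
    have diag: "res f * (\<Sum>x\<in>verts (contract G f). g' x x) =
        (\<Sum>x\<in>verts G. res f * g x x - drop f x * drop f x) - minor f"
    proof -
      have "(\<Sum>x\<in>verts G. g' x x) = g' (b f) (b f) + (\<Sum>x\<in>verts (contract G f). g' x x)"
        unfolding verts_contract[OF f graph nl] 
        by (rule sum.remove) (use f finite_verts in simp_all)
      then have "res f * (\<Sum>x\<in>verts (contract G f). g' x x) =
        (\<Sum>x\<in>verts G. res f * g' x x) - res f * g' (b f) (b f)"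
        by (simp add: distrib_left flip: sum_distrib_left)
      \<comment> \<open>This accounts for the vertex \<open>b f\<close>, which the contraction
        removes.\<close>
      moreover have "res f * g' (b f) (b f) = minor f"
        unfolding rg unfolding res_eq[OF f] minor_def drop_def
        using f by (simp add: sym power2_eq_square algebra_simps)
      ultimately show ?thesis unfolding rg by simp
    qed
    have minors: "res f * (\<Sum>e\<in>edges (contract G f). c.minor e / len G e) =
        (\<Sum>e\<in>edges G. (res f * c.minor e) / len G e)"
      using minor0 metrized_graphD(2)[OF graph] unfolding sum_distrib_left contract_simps
      by (intro sum.mono_neutral_cong_left) auto
    have ress: "res f * (\<Sum>e\<in>edges (contract G f). c.res e) = (\<Sum>e\<in>edges G. res f * c.res e)"
      using res0 metrized_graphD(2)[OF graph] unfolding sum_distrib_left contract_simps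
      by (intro sum.mono_neutral_cong_left) auto
    have "coeff G f * y_inv (contract G f) = (res f * (\<Sum>x\<in>verts (contract G f). g' x x) -
        res f * (\<Sum>e\<in>edges (contract G f). c.minor e / len G e)) / len G f"
      unfolding coeff_eq[OF f] c.y_inv_eq c.y_at_eq contract_simps(4)
      by (simp add: right_diff_distrib diff_divide_distrib)
    then have Y: ?Y unfolding diag minors by (simp add: minor' cong: sum.cong)
    have "coeff G f * (x_inv (contract G f) + y_inv (contract G f)) =
        res f * (\<Sum>e\<in>edges (contract G f). c.res e) / len G f"
      unfolding coeff_eq[OF f] c.y_inv_eq c.x_inv_eq c.x_at_eq by simp
    then have ?XY unfolding ress by (simp add: res' cong: sum.cong)
    with Y show ?thesis ..
  qed
  then show ?Y ?XY by auto
qed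

text \<open>Put \<open>n = v - 1\<close>. Foster and the energy identity give the diagonal the
  factor \<open>n - 1\<close>. The transformed minors get \<open>n - 2\<close>, as their corrections
  sum to twice the minor; the removed vertices supply one more, so all of \<open>y_inv\<close>
  scales by \<open>n - 1\<close>.\<close>

lemma sum_contract_y:
  "(\<Sum>f\<in>edges G. coeff G f * y_inv (contract G f)) = (real (card (verts G)) - 2) * y_inv G"
proof -
  let ?n = "real (card (verts G)) - 1"
  let ?m = "\<lambda>f e. (res f * minor e - g (a e) (a e) * (drop f (b e) * drop f (b e))
          - g (b e) (b e) * (drop f (a e) * drop f (a e))
          + 2 * g (a e) (b e) * (drop f (a e) * drop f (b e)))"
  have 1: "(\<Sum>f\<in>edges G. (\<Sum>x\<in>verts G. res f * g x x - drop f x * drop f x) / len G f) =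
      (?n - 1) * (\<Sum>x\<in>verts G. g x x)"
  proof -
    have "(\<Sum>f\<in>edges G. (\<Sum>x\<in>verts G. res f * g x x - drop f x * drop f x) / len G f) =
        (\<Sum>x\<in>verts G. \<Sum>f\<in>edges G. (res f * g x x - drop f x * drop f x) / len G f)"
      unfolding sum_divide_distrib by (rule sum.swap)
    also have "\<dots> = (\<Sum>x\<in>verts G. (\<Sum>f\<in>edges G. res f / len G f) * g x x -
        (\<Sum>f\<in>edges G. drop f x * drop f x / len G f))"
      by (simp add: sum_subtractf[symmetric] sum_distrib_right diff_divide_distrib)
    also have "\<dots> = (\<Sum>x\<in>verts G. (?n - 1) * g x x)"
      by (rule sum.cong) (simp_all add: foster sum_drop_drop algebra_simps)
    finally show ?thesis by (simp add: sum_distrib_left)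
  qed
  have 2: "(\<Sum>f\<in>edges G. (\<Sum>e\<in>edges G. ?m f e / len G e) / len G f) =
      (?n - 2) * (\<Sum>e\<in>edges G. minor e / len G e)"
  proof -
    have "(\<Sum>f\<in>edges G. (\<Sum>e\<in>edges G. ?m f e / len G e) / len G f) =
        (\<Sum>e\<in>edges G. \<Sum>f\<in>edges G. ?m f e / len G e / len G f)"
      unfolding sum_divide_distrib by (rule sum.swap)
    also have "\<dots> = (\<Sum>e\<in>edges G. (?n - 2) * (minor e / len G e))"
    proof (rule sum.cong)
      fix e assume e: "e \<in> edges G"
      have "(\<Sum>f\<in>edges G. ?m f e / len G e / len G f) =
          ((\<Sum>f\<in>edges G. res f / len G f) * minor e
          - g (a e) (a e) * (\<Sum>f\<in>edges G. drop f (b e) * drop f (b e) / len G f)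
          - g (b e) (b e) * (\<Sum>f\<in>edges G. drop f (a e) * drop f (a e) / len G f)
          + 2 * g (a e) (b e) * (\<Sum>f\<in>edges G. drop f (a e) * drop f (b e) / len G f)) / len G e"
        unfolding sum_distrib_left sum_distrib_right sum_subtractf[symmetric] sum.distrib[symmetric]
          sum_divide_distrib
        by (rule sum.cong) (simp_all add: add_divide_distrib diff_divide_distrib mult.commute)
      also have "\<dots> = (?n - 2) * (minor e / len G e)"
        using e by (simp add: foster sum_drop_drop minor_def power2_eq_square
          add_divide_distrib[symmetric] diff_divide_distrib[symmetric] algebra_simps)
      finally show "(\<Sum>f\<in>edges G. ?m f e / len G e / len G f) = (?n - 2) * (minor e / len G e)" .
    qed simp
    finally show ?thesis by (simp add: sum_distrib_left)
  qed
  have "(\<Sum>f\<in>edges G. coeff G f * y_inv (contract G f)) =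
      (\<Sum>f\<in>edges G. (\<Sum>x\<in>verts G. res f * g x x - drop f x * drop f x) / len G f) -
      (\<Sum>f\<in>edges G. minor f / len G f) -
      (\<Sum>f\<in>edges G. (\<Sum>e\<in>edges G. ?m f e / len G e) / len G f)"
    unfolding sum_subtractf[symmetric]
    by (rule sum.cong) (simp_all only: contract_step(1) diff_divide_distrib)
  also have "\<dots> = (?n - 1) * y_inv G"
    unfolding 1 2 y_inv_eq y_at_eq by (simp add: algebra_simps)
  finally show ?thesis by simp
qed

text \<open>For fixed \<open>e\<close> the squares, divided by \<open>len G f\<close>, sum over
  \<open>f\<close> to \<open>res e\<close> by the energy identity, and Foster contributes
  \<open>v - 1\<close> times \<open>res e\<close>.\<close>

lemma sum_contract_xy:
  "(\<Sum>f\<in>edges G. coeff G f * (x_inv (contract G f) + y_inv (contract G f))) =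
    (real (card (verts G)) - 2) * (x_inv G + y_inv G)"
proof -
  let ?n = "real (card (verts G)) - 1"
  let ?d = "\<lambda>f e. drop f (a e) - drop f (b e)"
  have "(\<Sum>f\<in>edges G. coeff G f * (x_inv (contract G f) + y_inv (contract G f))) =
      (\<Sum>f\<in>edges G. (\<Sum>e\<in>edges G. res f * res e - ?d f e * ?d f e) / len G f)"
    by (rule sum.cong) (simp_all only: contract_step(2))
  also have "\<dots> = (\<Sum>e\<in>edges G. \<Sum>f\<in>edges G. (res f * res e - ?d f e * ?d f e) / len G f)"
    unfolding sum_divide_distrib by (rule sum.swap)
  also have "\<dots> = (\<Sum>e\<in>edges G. (?n - 1) * res e)"
  proof (rule sum.cong)
    fix e assume e: "e \<in> edges G"
    have "(\<Sum>f\<in>edges G. (res f * res e - ?d f e * ?d f e) / len G f) =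
        (\<Sum>f\<in>edges G. res f / len G f) * res e
        - (\<Sum>f\<in>edges G. drop f (a e) * drop f (a e) / len G f)
        - (\<Sum>f\<in>edges G. drop f (b e) * drop f (b e) / len G f)
        + 2 * (\<Sum>f\<in>edges G. drop f (a e) * drop f (b e) / len G f)"
      unfolding sum_distrib_left sum_distrib_right sum_subtractf[symmetric] sum.distrib[symmetric]
      by (rule sum.cong)
        (simp_all add: add_divide_distrib[symmetric] diff_divide_distrib[symmetric] algebra_simps)
    also have "\<dots> = (?n - 1) * res e"
      unfolding foster using e by (simp add: sum_drop_drop res_eq algebra_simps)
    finally show "(\<Sum>f\<in>edges G. (res f * res e - ?d f e * ?d f e) / len G f) = (?n - 1) * res e" .
  qed simp
  also have "\<dots> = (?n - 1) * (x_inv G + y_inv G)"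
    unfolding x_inv_eq y_inv_eq x_at_eq by (simp add: sum_distrib_left)
  finally show ?thesis by simp
qed

lemma coeff_loop: "f \<in> edges G \<Longrightarrow> a f = b f \<Longrightarrow> coeff G f = 0"
  by (simp add: coeff_eq res_loop)

end

section \<open>Iteration\<close>

text \<open>The identity for \<open>x_inv\<close> is the one for the sum of both invariants minus
  the one for \<open>y_inv\<close>.\<close>

lemma sum_contract:
  assumes "metrized_graph G"
  shows "(\<Sum>f\<in>edges G. coeff G f * y_inv (contract G f)) = (real (card (verts G)) - 2) * y_inv G"
    and "(\<Sum>f\<in>edges G. coeff G f * x_inv (contract G f)) = (real (card (verts G)) - 2) * x_inv G"
    and "f \<in> edges G \<Longrightarrow> fst (ends G f) = snd (ends G f) \<Longrightarrow> coeff G f = 0"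
proof -
  obtain p where "p \<in> verts G" using metrized_graphD(3)[OF assms] by auto
  with assms obtain g where "green_kernel G p g" using green_kernel_exists by metis
  then interpret green_kernel G p g .
  show "f \<in> edges G \<Longrightarrow> fst (ends G f) = snd (ends G f) \<Longrightarrow> coeff G f = 0" by (rule coeff_loop)
  show "(\<Sum>f\<in>edges G. coeff G f * y_inv (contract G f)) = (real (card (verts G)) - 2) * y_inv G"
    by (rule sum_contract_y)
  then show "(\<Sum>f\<in>edges G. coeff G f * x_inv (contract G f)) = (real (card (verts G)) - 2) * x_inv G"
    using sum_contract_xy by (simp add: distrib_left sum.distrib)
qed

text \<open>The factor in the induction hypothesis depends only on the vertex count, which drops by
  one for each edge with distinct ends. Self-loops have coefficient 0, so the factor comes out of
  the whole sum and \<open>step\<close> applies.\<close>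

lemma csum_eq:
  fixes F :: "('v, 'e) mgraph \<Rightarrow> real"
  assumes step: "\<And>H. metrized_graph H \<Longrightarrow>
      (\<Sum>f\<in>edges H. coeff H f * F (contract H f)) = (real (card (verts H)) - 2) * F H"
    and "metrized_graph G" "k + 2 \<le> card (verts G)"
  shows "csum F k G = fact (card (verts G) - 2) / fact (card (verts G) - k - 2) * F G"
  using assms(2,3)
proof (induction k arbitrary: G)
  case (Suc k)
  note G = Suc.prems(1)
  \<comment> \<open>With this \<open>m\<close>, the factor after contraction is
    \<open>fact (m + k) / fact m\<close>, and \<open>step\<close> supplies the missing
    \<open>m + k + 1\<close>.\<close>
  obtain m where m: "card (verts G) = m + k + 3"
    using le_Suc_ex[OF Suc.prems(2)] by auto
  have "csum F (Suc k) G = (\<Sum>e\<in>edges G. fact (m + k) / fact m * (coeff G e * F (contract G e)))"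
    unfolding csum.simps
  proof (rule sum.cong)
    fix e assume e: "e \<in> edges G"
    show "coeff G e * csum F k (contract G e) = fact (m + k) / fact m * (coeff G e * F (contract G e))"
    proof (cases "fst (ends G e) = snd (ends G e)")
      case True
      then show ?thesis using sum_contract(3)[OF G e] by simp
    next
      case False
      have "card (verts (contract G e)) = m + k + 2"
        using verts_contract[OF e G False] m metrized_graphD(1,5)[OF G] e by simp
      then show ?thesis using Suc.IH[OF metrized_contract[OF G], of e] by simp
    qed
  qed simp
  also have "\<dots> = fact (m + k) / fact m * ((real (m + k + 3) - 2) * F G)"
    unfolding sum_distrib_left[symmetric] step[OF G] m ..
  also have "\<dots> = fact (Suc (m + k)) / fact m * F G"
    by (simp add: algebra_simps add_divide_distrib)
  also have "\<dots> = fact (card (verts G) - 2) / fact (card (verts G) - Suc k - 2) * F G"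
    by (simp add: m numeral_eq_Suc)
  finally show ?case .
qed simp

theorem theorem3p11:
  fixes G :: "('v, 'e) mgraph" and k :: nat
  assumes "metrized_graph G"
    and "card (verts G) \<ge> 3"
    and "1 \<le> k" and "k \<le> card (verts G) - 2"
  shows "(fact (card (verts G) - 2) / fact (card (verts G) - k - 2) :: real) * x_inv G
           = csum x_inv k G \<and>
         (fact (card (verts G) - 2) / fact (card (verts G) - k - 2) :: real) * y_inv G
           = csum y_inv k G"
  using csum_eq[OF sum_contract(2) assms(1)] csum_eq[OF sum_contract(1) assms(1)] assms(2,4) by simp

end
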